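(* For $n\ge 2$, $\chi_{lat}(P_n)=2$, except that $\chi_{lat}(P_4)=3$.
   Context: $P_n$ is the path of order $n\ge 2$ (with $n$ vertices). For a finite simple graph $G$ of order $p$ and size $q$, a local antimagic total labeling of $G$ is a bijection $f:V(G)\cup E(G)\to\{1,\ldots,p+q\}$ such that $w_f(u)\neq w_f(v)$ for every edge $uv$ of $G$, where $w_f(u)=f(u)+\sum_{ux\in E(G)}f(ux)$. $\chi_{lat}(G)$ is the minimum number of distinct values of $w_f$ over all local antimagic total labelings $f$ of $G$. *)

theory Defs
  imports Main
begin

type_synonym 'a ugraph = "'a set \<times> 'a set set"

abbreviation verts :: "'a ugraph \<Rightarrow> 'a set" where
  "verts G \<equiv> fst G"

abbreviation edges :: "'a ugraph \<Rightarrow> 'a set set" where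
  "edges G \<equiv> snd G"

definition finite_simple_graph :: "'a ugraph \<Rightarrow> bool" where
  "finite_simple_graph G \<longleftrightarrow>
     finite (verts G) \<and> (\<forall>e\<in>edges G. e \<subseteq> verts G \<and> card e = 2)"

text \<open>A total labeling is a function on the disjoint sum of vertices and edges:
  the label of a vertex \<open>u\<close> is \<open>f (Inl u)\<close> and the label of an edge \<open>{u, v}\<close> is
  \<open>f (Inr {u, v})\<close>.\<close>

definition vertex_weight :: "'a ugraph \<Rightarrow> ('a + 'a set \<Rightarrow> nat) \<Rightarrow> 'a \<Rightarrow> nat" where
  "vertex_weight G f u = f (Inl u) + (\<Sum>x | {u, x} \<in> edges G. f (Inr {u, x}))"

definition local_antimagic_total_labeling ::
    "'a ugraph \<Rightarrow> ('a + 'a set \<Rightarrow> nat) \<Rightarrow> bool" where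
  "local_antimagic_total_labeling G f \<longleftrightarrow>
     bij_betw f (verts G <+> edges G) {1..card (verts G) + card (edges G)} \<and>
     (\<forall>u v. {u, v} \<in> edges G \<longrightarrow> vertex_weight G f u \<noteq> vertex_weight G f v)"

text \<open>Meaningful for finite simple graphs admitting such a labeling; for other graphs
  the value is unspecified.\<close>

definition chi_lat :: "'a ugraph \<Rightarrow> nat" where
  "chi_lat G =
     (LEAST k. \<exists>f. local_antimagic_total_labeling G f \<and>
                   k = card (vertex_weight G f ` verts G))"

definition path_graph :: "nat \<Rightarrow> nat ugraph" where
  "path_graph n = ({1..n}, {{i, i + 1} | i. 1 \<le> i \<and> i < n})"

lemma finite_simple_graph_path_graph: "finite_simple_graph (path_graph n)"
  by (auto simp: finite_simple_graph_def path_graph_def)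

end

theory Submission
  imports Defs
begin

text \<open>
  Two adjacent vertices have different weights, so every labeling of a path with at least two
  vertices has at least two weights. For every order other than four an explicit labeling
  attains two.

  With exactly two weights, the odd vertices all have one weight \<open>A\<close> and the even vertices the
  other weight \<open>B\<close>, so the edge labels determine the vertex labels (\<open>two_weight_pathI\<close>). Let the
  edges \<open>{2 * j, 2 * j + 1}\<close> carry the labels \<open>1, 2, 3, \<dots>\<close> in order. Then, except at the end of
  the path, the labels of the vertices \<open>2 * j - 1\<close> and \<open>2 * j\<close> differ by a constant. The task is to
  choose the labels \<open>F j\<close> of the remaining edges such that the values \<open>F j\<close>, the values
  \<open>A - (j - 1) - F j\<close>, and the translates of the latter tile the remaining numbers.

  Two patterns achieve this. The first one is an interval of odd length whose values are
  assigned to \<open>F\<close> in increasing order, rotated by half of its length: along it \<open>j + F j\<close> increases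
  in steps of two, and the rotation changes the parity, so the two halves of \<open>j + F j\<close> interlock to
  another interval. One such block solves the orders \<open>4 * h + 2\<close>. A block of even length cannot
  work, since the sum of the values \<open>j + F j\<close> would not be that of an interval; for \<open>8 * t\<close> and
  \<open>8 * t + 4\<close> two blocks of odd length are used. The second pattern, for odd orders, treats even
  and odd \<open>j\<close> separately and lets \<open>F j\<close> increase by one as \<open>j\<close> decreases by two, so that
  \<open>j + F j\<close> runs through an interval as well. In both patterns one collision of labels may be
  left over. It is removed by exchanging the label of one edge with that of its odd end:
  this preserves the weight of the odd end and moves only the label of the even end.

  For four vertices, a finite check shows that two alternating weights are necessarily equal,
  while three weights are attained.
\<close>

section \<open>Weights and labelings on a path\<close>

lemma edge_path_graph_iff:
  "{u, x} \<in> edges (path_graph n) \<longleftrightarrow>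
     (x = u + 1 \<and> 1 \<le> u \<and> u < n) \<or> (u = x + 1 \<and> 1 \<le> x \<and> x < n)"
  by (auto simp: path_graph_def doubleton_eq_iff)

lemma vertex_weight_path_graph:
  assumes "1 \<le> u" "u \<le> n"
  shows "vertex_weight (path_graph n) f u =
     (if u = 1 then 0 else f (Inr {u - 1, u})) + f (Inl u) + (if u = n then 0 else f (Inr {u, u + 1}))"
proof -
  have nb: "{x. {u, x} \<in> edges (path_graph n)} =
      (if u = 1 then {} else {u - 1}) \<union> (if u = n then {} else {u + 1})"
    using assms by (auto simp: edge_path_graph_iff)
  show ?thesis
    unfolding vertex_weight_def nb using assms by (auto simp: insert_commute)
qed

lemma edges_path_graph_eq: "edges (path_graph n) = (\<lambda>i. {i, i + 1}) ` {1..<n}"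
  by (auto simp: path_graph_def)

lemma card_edges_path_graph: "card (edges (path_graph n)) = n - 1"
proof -
  have "inj_on (\<lambda>i::nat. {i, i + 1}) {1..<n}"
    by (auto simp: inj_on_def doubleton_eq_iff)
  then show ?thesis
    by (simp add: edges_path_graph_eq card_image)
qed

lemma card_verts_path_graph [simp]: "card (verts (path_graph n)) = n"
  by (simp add: path_graph_def)

text \<open>Between finite sets of equal size a map that hits every target is a bijection. So an
  explicit labeling only has to be shown to use every label; no two pieces of its definition
  ever have to be compared.\<close>

lemma bij_betw_if_covers:
  assumes "finite X" "card X = card Y" "Y \<subseteq> f ` X"
  shows "bij_betw f X Y"
proof -
  have "card (f ` X) \<le> card Y"
    using assms card_image_le by metis
  then have "f ` X = Y"
    using assms card_seteq[of "f ` X" Y] by auto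
  then show ?thesis
    using assms eq_card_imp_inj_on[of X f] by (auto simp: bij_betw_def)
qed

text \<open>An edge of a path is determined by its smaller end, so \<open>g i\<close> is the label of \<open>{i, i + 1}\<close>.\<close>

definition path_labeling :: "(nat \<Rightarrow> nat) \<Rightarrow> (nat \<Rightarrow> nat) \<Rightarrow> nat + nat set \<Rightarrow> nat" where
  "path_labeling v g = case_sum v (\<lambda>e. g (Min e))"

lemma bij_path_labeling:
  assumes "n \<ge> 1"
    and cover: "\<And>c. 1 \<le> c \<Longrightarrow> c \<le> 2 * n - 1 \<Longrightarrow> c \<in> v ` {1..n} \<or> c \<in> g ` {1..<n}"
  shows "bij_betw (path_labeling v g) (verts (path_graph n) <+> edges (path_graph n))
     {1..card (verts (path_graph n)) + card (edges (path_graph n))}"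
proof (rule bij_betw_if_covers)
  have fin: "finite (verts (path_graph n))" "finite (edges (path_graph n))"
    by (auto simp: edges_path_graph_eq) (simp add: path_graph_def)
  then show "finite (verts (path_graph n) <+> edges (path_graph n))"
    by simp
  show "card (verts (path_graph n) <+> edges (path_graph n)) =
      card {1..card (verts (path_graph n)) + card (edges (path_graph n))}"
    using fin by (simp add: card_Plus)
  show "{1..card (verts (path_graph n)) + card (edges (path_graph n))}
      \<subseteq> path_labeling v g ` (verts (path_graph n) <+> edges (path_graph n))"
  proof
    fix c assume "c \<in> {1..card (verts (path_graph n)) + card (edges (path_graph n))}"
    then have "1 \<le> c" "c \<le> 2 * n - 1"
      using assms(1) by (auto simp: card_edges_path_graph)
    from cover[OF this] show "c \<in> path_labeling v g ` (verts (path_graph n) <+> edges (path_graph n))"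
    proof
      assume "c \<in> v ` {1..n}"
      then obtain i where "i \<in> {1..n}" "c = path_labeling v g (Inl i)"
        by (auto simp: path_labeling_def)
      moreover from this have "Inl i \<in> verts (path_graph n) <+> edges (path_graph n)"
        by (auto simp: path_graph_def)
      ultimately show ?thesis by blast
    next
      assume "c \<in> g ` {1..<n}"
      then obtain i where "i \<in> {1..<n}" "c = path_labeling v g (Inr {i, i + 1})"
        by (auto simp: path_labeling_def)
      moreover from this have "Inr {i, i + 1} \<in> verts (path_graph n) <+> edges (path_graph n)"
        by (auto simp: edges_path_graph_eq)
      ultimately show ?thesis by blast
    qed
  qed
qed

text \<open>With the labels \<open>g 0\<close> and \<open>g n\<close> of the two missing edges set to \<open>0\<close>, the weight formula is the same
  at the ends of the path as in its interior.\<close>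

lemma vertex_weight_path_labeling:
  assumes "1 \<le> u" "u \<le> n" "g 0 = 0" "g n = 0"
  shows "vertex_weight (path_graph n) (path_labeling v g) u = g (u - 1) + v u + g u"
  using assms by (auto simp: vertex_weight_path_graph path_labeling_def)

definition two_weight_path :: "nat \<Rightarrow> bool" where
  "two_weight_path n \<longleftrightarrow> (\<exists>f. local_antimagic_total_labeling (path_graph n) f \<and>
     card (vertex_weight (path_graph n) f ` verts (path_graph n)) = 2)"

text \<open>Adjacent vertices have indices of opposite parity, so two weights must alternate: \<open>A\<close> at odd
  and \<open>B\<close> at even vertices. Once the edge labels \<open>g\<close> are fixed, the vertex labels are forced to be
  the differences to \<open>A\<close> or \<open>B\<close>, and all that remains is that every number up to \<open>2 * n - 1\<close> is
  such a difference or an edge label.\<close>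

lemma two_weight_pathI:
  fixes g :: "nat \<Rightarrow> nat" and A B :: nat
  defines "W \<equiv> \<lambda>i. if odd i then A else B"
  assumes n: "n \<ge> 2" and AB: "A \<noteq> B" and g0: "g 0 = 0" "g n = 0"
    and le: "\<And>i. 1 \<le> i \<Longrightarrow> i \<le> n \<Longrightarrow> g (i - 1) + g i \<le> W i"
    and cover: "\<And>c. 1 \<le> c \<Longrightarrow> c \<le> 2 * n - 1 \<Longrightarrow>
       (\<exists>i. 1 \<le> i \<and> i < n \<and> g i = c) \<or> (\<exists>i. 1 \<le> i \<and> i \<le> n \<and> g (i - 1) + g i + c = W i)"
  shows "two_weight_path n"
proof -
  define v where "v = (\<lambda>i. W i - (g (i - 1) + g i))"
  define f where "f = path_labeling v g"
  have w: "vertex_weight (path_graph n) f i = W i" if "1 \<le> i" "i \<le> n" for i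
    using that le[OF that] g0 by (simp add: f_def vertex_weight_path_labeling v_def)
  have "bij_betw f (verts (path_graph n) <+> edges (path_graph n))
     {1..card (verts (path_graph n)) + card (edges (path_graph n))}"
    unfolding f_def
  proof (rule bij_path_labeling)
    fix c assume "1 \<le> c" "c \<le> 2 * n - 1"
    from cover[OF this] show "c \<in> v ` {1..n} \<or> c \<in> g ` {1..<n}"
    proof (elim disjE exE conjE)
      fix i assume "1 \<le> i" "i \<le> n" "g (i - 1) + g i + c = W i"
      then have "i \<in> {1..n}" "v i = c"
        by (auto simp: v_def)
      then show ?thesis by blast
    qed auto
  qed (use n in simp)
  moreover have "vertex_weight (path_graph n) f a \<noteq> vertex_weight (path_graph n) f b"
    if "{a, b} \<in> edges (path_graph n)" for a b
    using that AB by (auto simp: edge_path_graph_iff w W_def split: if_splits)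
  ultimately have lat: "local_antimagic_total_labeling (path_graph n) f"
    by (simp add: local_antimagic_total_labeling_def)
  have "verts (path_graph n) = {1..n}"
    by (simp add: path_graph_def)
  then have "vertex_weight (path_graph n) f ` verts (path_graph n) = W ` {1..n}"
    by (intro image_cong) (auto simp: w)
  also have "\<dots> = {A, B}"
  proof
    show "{A, B} \<subseteq> W ` {1..n}"
      using n image_eqI[of A W 1 "{1..n}"] image_eqI[of B W 2 "{1..n}"] by (simp add: W_def)
  qed (auto simp: W_def)
  finally show ?thesis
    using lat AB by (auto simp: two_weight_path_def)
qed

text \<open>All constructions below give the edge \<open>{2 * j, 2 * j + 1}\<close> the label \<open>j\<close>, which uses up the smallest
  labels; \<open>F j\<close> is the label of the edge \<open>{2 * j - 1, 2 * j}\<close>. Then \<open>A - (j - 1) - F j\<close> and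
  \<open>B - j - F j\<close> are the labels of the vertices \<open>2 * j - 1\<close> and \<open>2 * j\<close>, which differ by the
  constant \<open>B - A - 1\<close>. The exception is the last vertex \<open>2 * k\<close>: it has no edge to its
  right, and its label is \<open>B - F k\<close>.\<close>

lemma two_weight_even_path:
  fixes F :: "nat \<Rightarrow> nat" and A B k :: nat
  assumes k: "k \<ge> 1" and AB: "A \<noteq> B"
    and le: "\<And>j. 1 \<le> j \<Longrightarrow> j \<le> k \<Longrightarrow> F j + j \<le> min A B"
    and cover: "\<And>c. k \<le> c \<Longrightarrow> c < 4 * k \<Longrightarrow> F k + c = B \<or>
       (\<exists>j. 1 \<le> j \<and> j \<le> k \<and> (F j = c \<or> (j - 1) + F j + c = A \<or> j < k \<and> F j + j + c = B))"
  shows "two_weight_path (2 * k)"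
proof -
  define g where "g = (\<lambda>i. if i \<ge> 2 * k then 0 else if odd i then F ((i + 1) div 2) else i div 2)"
  have gE: "g (2 * j) = (if j < k then j else 0)" for j
    by (simp add: g_def)
  have gO: "g (2 * j - 1) = F j" if "1 \<le> j" "j \<le> k" for j
    using that by (cases j) (auto simp: g_def)
  have gE': "g (2 * j - 1 - 1) = j - 1" if "1 \<le> j" "j \<le> k" for j
    using that by (cases j) (auto simp: g_def)
  show ?thesis
  proof (rule two_weight_pathI[of _ A B g])
    show "2 * k \<ge> 2" "A \<noteq> B" "g 0 = 0" "g (2 * k) = 0"
      using k AB by (auto simp: g_def)
  next
    fix i assume i: "1 \<le> i" "i \<le> 2 * k"
    show "g (i - 1) + g i \<le> (if odd i then A else B)"
    proof (cases "odd i")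
      case True
      then obtain j where j: "i = 2 * j - 1" "1 \<le> j" "j \<le> k"
        using i by (auto elim!: oddE intro!: that[of "(i + 1) div 2"])
      have "g (i - 1) + g i = (j - 1) + F j"
        unfolding j(1) gO[OF j(2,3)] gE'[OF j(2,3)] ..
      then show ?thesis using le[OF j(2,3)] True by auto
    next
      case False
      then obtain j where j: "i = 2 * j" "1 \<le> j" "j \<le> k"
        using i by (auto elim!: evenE)
      have "g (i - 1) + g i = F j + (if j < k then j else 0)"
        unfolding j(1) gO[OF j(2,3)] gE ..
      then show ?thesis using le[OF j(2,3)] False by auto
    qed
  next
    fix c assume c: "1 \<le> c" "c \<le> 2 * (2 * k) - 1"
    let ?P = "\<exists>i. 1 \<le> i \<and> i < 2 * k \<and> g i = c"
    let ?Q = "\<exists>i. 1 \<le> i \<and> i \<le> 2 * k \<and> g (i - 1) + g i + c = (if odd i then A else B)"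
    have PO: ?P if "1 \<le> j" "j \<le> k" "F j = c" for j
      using that gO[of j] by (intro exI[of _ "2 * j - 1"]) auto
    have QO: ?Q if "1 \<le> j" "j \<le> k" "(j - 1) + F j + c = A" for j
      using that gO[of j] gE'[of j] by (intro exI[of _ "2 * j - 1"]) auto
    have QE: ?Q if "1 \<le> j" "j \<le> k" "F j + (if j < k then j else 0) + c = B" for j
      using that gO[of j] gE[of j] by (intro exI[of _ "2 * j"]) auto
    show "?P \<or> ?Q"
    proof (cases "c < k")
      case True
      then show ?thesis using c gE[of c] by (intro disjI1 exI[of _ "2 * c"]) auto
    next
      case False
      then have "k \<le> c" "c < 4 * k" using c k by auto
      from cover[OF this] show ?thesis
      proof (elim disjE exE conjE)
        assume "F k + c = B"
        then show ?thesis using QE[of k] k by simp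
      qed (use PO QO QE in auto)
    qed
  qed
qed

text \<open>Here the path ends with the vertex \<open>2 * k + 1\<close>, whose only edge has label \<open>k\<close>; its own label is
  therefore \<open>A - k\<close>.\<close>

lemma two_weight_odd_path:
  fixes F :: "nat \<Rightarrow> nat" and A B k :: nat
  assumes k: "k \<ge> 1" and AB: "A \<noteq> B"
    and le: "\<And>j. 1 \<le> j \<Longrightarrow> j \<le> k \<Longrightarrow> F j + j \<le> min A B"
    and cover: "\<And>c. k < c \<Longrightarrow> c \<le> 4 * k + 1 \<Longrightarrow> k + c = A \<or>
       (\<exists>j. 1 \<le> j \<and> j \<le> k \<and> (F j = c \<or> (j - 1) + F j + c = A \<or> F j + j + c = B))"
  shows "two_weight_path (2 * k + 1)"
proof -
  define g where "g = (\<lambda>i. if i > 2 * k then 0 else if odd i then F ((i + 1) div 2) else i div 2)"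
  have gE: "g (2 * j) = j" if "j \<le> k" for j
    using that by (simp add: g_def)
  have gO: "g (2 * j - 1) = (if j \<le> k then F j else 0)" if "1 \<le> j" for j
    using that by (cases j) (auto simp: g_def)
  have gE': "g (2 * j - 1 - 1) = j - 1" if "1 \<le> j" "j \<le> k + 1" for j
    using that by (cases j) (auto simp: g_def)
  show ?thesis
  proof (rule two_weight_pathI[of _ A B g])
    show "2 * k + 1 \<ge> 2" "A \<noteq> B" "g 0 = 0" "g (2 * k + 1) = 0"
      using k AB by (auto simp: g_def)
  next
    fix i assume i: "1 \<le> i" "i \<le> 2 * k + 1"
    show "g (i - 1) + g i \<le> (if odd i then A else B)"
    proof (cases "odd i")
      case True
      then obtain j where j: "i = 2 * j - 1" "1 \<le> j" "j \<le> k + 1"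
        using i by (auto elim!: oddE intro!: that[of "(i + 1) div 2"])
      have "g (i - 1) + g i = (j - 1) + (if j \<le> k then F j else 0)"
        unfolding j(1) gO[OF j(2)] gE'[OF j(2,3)] ..
      then show ?thesis using le[OF j(2)] le[of k] k j(3) True by (cases "j \<le> k") auto
    next
      case False
      then obtain j where j: "i = 2 * j" "1 \<le> j" "j \<le> k"
        using i by (auto elim!: evenE)
      have "g (i - 1) + g i = F j + j"
        unfolding j(1) gO[OF j(2)] gE[OF j(3)] using j(3) by simp
      then show ?thesis using le[OF j(2,3)] False by simp
    qed
  next
    fix c assume c: "1 \<le> c" "c \<le> 2 * (2 * k + 1) - 1"
    let ?P = "\<exists>i. 1 \<le> i \<and> i < 2 * k + 1 \<and> g i = c"
    let ?Q = "\<exists>i. 1 \<le> i \<and> i \<le> 2 * k + 1 \<and> g (i - 1) + g i + c = (if odd i then A else B)"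
    have PO: ?P if "1 \<le> j" "j \<le> k" "F j = c" for j
      using that gO[of j] by (intro exI[of _ "2 * j - 1"]) auto
    have QO: ?Q if "1 \<le> j" "j \<le> k + 1" "(j - 1) + (if j \<le> k then F j else 0) + c = A" for j
      using that gO[of j] gE'[of j] by (intro exI[of _ "2 * j - 1"]) auto
    have QE: ?Q if "1 \<le> j" "j \<le> k" "F j + j + c = B" for j
      using that gO[of j] gE[of j] by (intro exI[of _ "2 * j"]) auto
    show "?P \<or> ?Q"
    proof (cases "c \<le> k")
      case True
      then show ?thesis using c gE[of c] by (intro disjI1 exI[of _ "2 * c"]) auto
    next
      case False
      then have "k < c" "c \<le> 4 * k + 1" using c by auto
      from cover[OF this] show ?thesis
      proof (elim disjE exE conjE)
        assume "k + c = A"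
        then show ?thesis using QO[of "k + 1"] by simp
      qed (use PO QO QE in auto)
    qed
  qed
qed

section \<open>Even orders\<close>

text \<open>The values \<open>2 * h + 1, \<dots>, 4 * h + 1\<close> of \<open>F\<close> are rotated by half of their odd number. The odd
  vertices get the interval from \<open>4 * h + 2\<close> to \<open>6 * h + 2\<close>, with its least element at
  \<open>j = 2 * h + 1\<close>. The even vertices get the same interval raised by \<open>2 * h\<close>, except that the last
  vertex lacks an edge and has the largest label instead; exactly the overlap of the two
  intervals disappears.\<close>

lemma two_weight_path_4h_plus_2:
  shows "two_weight_path (4 * h + 2)"
proof -
  define F where "F = (\<lambda>j. if j \<le> h then j + 3 * h + 1 else j + h)"
  have F1: "F j = j + 3 * h + 1" if "j \<le> h" for j
    using that by (simp add: F_def)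
  have F2: "F j = j + h" if "h < j" for j
    using that by (simp add: F_def)
  have Fmax: "F j \<le> 4 * h + 1" if "1 \<le> j" "j \<le> 2 * h + 1" for j
    using that by (auto simp: F_def)
  have tw: "two_weight_path (2 * (2 * h + 1))"
  proof (rule two_weight_even_path[of _ "9 * h + 3" "11 * h + 4" F])
    fix c assume c: "2 * h + 1 \<le> c" "c < 4 * (2 * h + 1)"
    then have c4: "c < 8 * h + 4" by simp
    let ?goal = "F (2 * h + 1) + c = 11 * h + 4 \<or> (\<exists>j. 1 \<le> j \<and> j \<le> 2 * h + 1 \<and> (F j = c \<or>
        (j - 1) + F j + c = 9 * h + 3 \<or> j < 2 * h + 1 \<and> F j + j + c = 11 * h + 4))"
    have edge: ?goal if "1 \<le> j" "j \<le> 2 * h + 1" "F j = c" for j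
      using that by blast
    have odd: ?goal if "1 \<le> j" "j \<le> 2 * h + 1" "(j - 1) + F j + c = 9 * h + 3" for j
      using that by blast
    have even: ?goal if "1 \<le> j" "j < 2 * h + 1" "F j + j + c = 11 * h + 4" for j
      using that less_imp_le by blast
    \<comment> \<open>the labels from bottom to top; where the two halves of a rotated block interlock,
      the parity of \<open>c\<close> tells them apart\<close>
    consider "c \<le> 3 * h + 1"
      | "3 * h + 1 < c" "c \<le> 4 * h + 1"
      | "4 * h + 1 < c" "c \<le> 6 * h + 2"
      | "6 * h + 2 < c" "c \<le> 8 * h + 2"
      | "8 * h + 2 < c"
      using not_le by blast
    then show ?goal
    proof cases
      case 1
      \<comment> \<open>only the last of the three side conditions mentions \<open>F\<close>, so the rewrite step is optional\<close>
      show ?thesis by (rule edge[of "c - h"]; (subst F2)?; use 1 c c4 in linarith)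
    next
      case 2
      show ?thesis by (rule edge[of "c - 3 * h - 1"]; (subst F1)?; use 2 c c4 in linarith)
    next
      case 3
      show ?thesis
      proof (cases "even c")
        case True
        then obtain d where d: "c = 2 * d" by (elim evenE)
        show ?thesis by (rule odd[of "4 * h + 2 - d"]; (subst F2)?; use d 3 c c4 in linarith)
      next
        case False
        then obtain d where d: "c = 2 * d + 1" by (elim oddE)
        show ?thesis by (rule odd[of "3 * h + 1 - d"]; (subst F1)?; use d 3 c c4 in linarith)
      qed
    next
      case 4
      show ?thesis
      proof (cases "even c")
        case True
        then obtain d where d: "c = 2 * d" by (elim evenE)
        show ?thesis by (rule even[of "5 * h + 2 - d"]; (subst F2)?; use d 4 c c4 in linarith)
      next
        case False
        then obtain d where d: "c = 2 * d + 1" by (elim oddE)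
        show ?thesis by (rule even[of "4 * h + 1 - d"]; (subst F1)?; use d 4 c c4 in linarith)
      qed
    next
      case 5
      show ?thesis by (intro disjI1; subst F2; use 5 c c4 in linarith)
    qed
  next
    fix j assume "1 \<le> j" "j \<le> 2 * h + 1"
    then show "F j + j \<le> min (9 * h + 3) (11 * h + 4)" using Fmax[of j] by simp
  qed auto
  have "4 * h + 2 = 2 * (2 * h + 1)"
    by simp
  with tw show ?thesis
    by (simp only:)
qed

text \<open>Two rotated blocks, of lengths \<open>2 * t - 1\<close> and \<open>2 * t + 1\<close>; consecutive vertices \<open>2 * j - 1\<close> and
  \<open>2 * j\<close> have labels differing by \<open>2 * t\<close>. The second block behaves as in the previous lemma, but
  the last vertex now gets the label \<open>14 * t\<close>. That label is the gap between the labels of the odd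
  and of the even vertices of the first block, because the block is one shorter than the
  distance \<open>2 * t\<close> of the two kinds. The lengths differ by two to make both fit.\<close>

lemma two_weight_path_8t:
  assumes "t \<ge> 1"
  shows "two_weight_path (8 * t)"
proof -
  define F where "F = (\<lambda>j. if j \<le> t then j + 5 * t - 2
    else if 2 * t \<le> j \<and> j < 3 * t then j + 5 * t else j + 3 * t - 1)"
  have F1: "F j = j + 5 * t - 2" if "j \<le> t" for j
    using that by (simp add: F_def)
  have F2: "F j = j + 3 * t - 1" if "t < j" "j < 2 * t" for j
    using that by (simp add: F_def)
  have F3: "F j = j + 5 * t" if "t < j" "2 * t \<le> j" "j < 3 * t" for j
    using that by (simp add: F_def)
  have F4: "F j = j + 3 * t - 1" if "t < j" "3 * t \<le> j" for j
    using that by (simp add: F_def)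
  have Fmax: "F j \<le> 8 * t - 1" if "1 \<le> j" "j \<le> 4 * t" for j
    using that assms by (auto simp: F_def)
  have tw: "two_weight_path (2 * (4 * t))"
  proof (rule two_weight_even_path[of _ "19 * t - 2" "21 * t - 1" F])
    fix c assume c: "4 * t \<le> c" "c < 4 * (4 * t)"
    let ?goal = "F (4 * t) + c = 21 * t - 1 \<or> (\<exists>j. 1 \<le> j \<and> j \<le> 4 * t \<and> (F j = c \<or>
        (j - 1) + F j + c = 19 * t - 2 \<or> j < 4 * t \<and> F j + j + c = 21 * t - 1))"
    have edge: ?goal if "1 \<le> j" "j \<le> 4 * t" "F j = c" for j
      using that by blast
    have odd: ?goal if "1 \<le> j" "j \<le> 4 * t" "(j - 1) + F j + c = 19 * t - 2" for j
      using that by blast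
    have even: ?goal if "1 \<le> j" "j < 4 * t" "F j + j + c = 21 * t - 1" for j
      using that less_imp_le by blast
    consider "c \<le> 5 * t - 2"
      | "5 * t - 2 < c" "c \<le> 6 * t - 2"
      | "6 * t - 2 < c" "c \<le> 7 * t - 1"
      | "7 * t - 1 < c" "c \<le> 8 * t - 1"
      | "8 * t - 1 < c" "c \<le> 10 * t"
      | "10 * t < c" "c \<le> 12 * t"
      | "12 * t < c" "c \<le> 14 * t - 1"
      | "14 * t - 1 < c" "c \<le> 14 * t"
      | "14 * t < c"
      using not_le by blast
    then show ?goal
    proof cases
      case 1
      show ?thesis by (rule edge[of "c + 1 - 3 * t"]; (subst F2)?; use 1 c assms in linarith)
    next
      case 2
      show ?thesis by (rule edge[of "c + 2 - 5 * t"]; (subst F1)?; use 2 c assms in linarith)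
    next
      case 3
      show ?thesis by (rule edge[of "c + 1 - 3 * t"]; (subst F4)?; use 3 c assms in linarith)
    next
      case 4
      show ?thesis by (rule edge[of "c - 5 * t"]; (subst F3)?; use 4 c assms in linarith)
    next
      case 5
      show ?thesis
      proof (cases "even c")
        case True
        then obtain d where d: "c = 2 * d" by (elim evenE)
        show ?thesis by (rule odd[of "8 * t - d"]; (subst F4)?; use d 5 c assms in linarith)
      next
        case False
        then obtain d where d: "c = 2 * d + 1" by (elim oddE)
        show ?thesis by (rule odd[of "7 * t - 1 - d"]; (subst F3)?; use d 5 c assms in linarith)
      qed
    next
      case 6
      show ?thesis
      proof (cases "even c")
        case True
        then obtain d where d: "c = 2 * d" by (elim evenE)
        show ?thesis by (rule even[of "9 * t - d"]; (subst F4)?; use d 6 c assms in linarith)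
      next
        case False
        then obtain d where d: "c = 2 * d + 1" by (elim oddE)
        show ?thesis by (rule even[of "8 * t - 1 - d"]; (subst F3)?; use d 6 c assms in linarith)
      qed
    next
      case 7
      show ?thesis
      proof (cases "even c")
        case True
        then obtain d where d: "c = 2 * d" by (elim evenE)
        show ?thesis by (rule odd[of "8 * t - d"]; (subst F2)?; use d 7 c assms in linarith)
      next
        case False
        then obtain d where d: "c = 2 * d + 1" by (elim oddE)
        show ?thesis by (rule odd[of "7 * t - d"]; (subst F1)?; use d 7 c assms in linarith)
      qed
    next
      case 8
      show ?thesis by (intro disjI1; subst F4; use 8 c assms in linarith)
    next
      case 9
      show ?thesis
      proof (cases "even c")
        case True
        then obtain d where d: "c = 2 * d" by (elim evenE)
        show ?thesis by (rule even[of "9 * t - d"]; (subst F2)?; use d 9 c assms in linarith)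
      next
        case False
        then obtain d where d: "c = 2 * d + 1" by (elim oddE)
        show ?thesis by (rule even[of "8 * t - d"]; (subst F1)?; use d 9 c assms in linarith)
      qed
    qed
  next
    fix j assume "1 \<le> j" "j \<le> 4 * t"
    then show "F j + j \<le> min (19 * t - 2) (21 * t - 1)" using Fmax[of j] assms by simp
  qed (use assms in auto)
  have "8 * t = 2 * (4 * t)"
    by simp
  with tw show ?thesis
    by (simp only:)
qed

text \<open>Write \<open>s = 2 * t + 1\<close>. Two rotated blocks of the same length \<open>s\<close> are used, and the label of the
  vertex \<open>2 * j\<close> is \<open>s\<close> below that of \<open>2 * j - 1\<close>. The last vertex then has the label \<open>6 * s\<close>, which
  collides with the vertex belonging to the middle \<open>j = t + 1\<close> of the first block: there the edge,
  its odd end and its even end would have the labels \<open>3 * s\<close>, \<open>7 * s\<close> and \<open>6 * s\<close>. Exchanging the first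
  two turns the third one into \<open>2 * s\<close>, the only label not used so far. For \<open>t = 0\<close> the two
  weights coincide.\<close>

lemma two_weight_path_8t_plus_4:
  assumes "t \<ge> 1"
  shows "two_weight_path (8 * t + 4)"
proof -
  define F where "F = (\<lambda>j. if j = t + 1 then 14 * t + 7 else if j \<le> t then j + 5 * t + 2
    else if j \<le> 2 * t + 1 then j + 3 * t + 1 else if j \<le> 3 * t + 1 then j + 5 * t + 3
    else j + 3 * t + 2)"
  have F1: "F j = 14 * t + 7" if "j = t + 1" for j
    using that by (simp add: F_def)
  have F2: "F j = j + 5 * t + 2" if "j \<le> t" for j
    using that by (simp add: F_def)
  have F3: "F j = j + 3 * t + 1" if "t + 1 < j" "j \<le> 2 * t + 1" for j
    using that by (simp add: F_def)
  have F4: "F j = j + 5 * t + 3" if "2 * t + 1 < j" "j \<le> 3 * t + 1" for j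
    using that by (simp add: F_def)
  have F5: "F j = j + 3 * t + 2" if "3 * t + 1 < j" for j
    using that by (simp add: F_def)
  have Fmax: "F j \<le> 14 * t + 7" if "1 \<le> j" "j \<le> 4 * t + 2" for j
    using that assms by (auto simp: F_def)
  have tw: "two_weight_path (2 * (4 * t + 2))"
  proof (rule two_weight_even_path[of _ "21 * t + 10" "19 * t + 10" F])
    fix c assume c: "4 * t + 2 \<le> c" "c < 4 * (4 * t + 2)"
    then have c4: "c < 16 * t + 8" by simp
    let ?goal = "F (4 * t + 2) + c = 19 * t + 10 \<or> (\<exists>j. 1 \<le> j \<and> j \<le> 4 * t + 2 \<and> (F j = c \<or>
        (j - 1) + F j + c = 21 * t + 10 \<or> j < 4 * t + 2 \<and> F j + j + c = 19 * t + 10))"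
    have edge: ?goal if "1 \<le> j" "j \<le> 4 * t + 2" "F j = c" for j
      using that by blast
    have odd: ?goal if "1 \<le> j" "j \<le> 4 * t + 2" "(j - 1) + F j + c = 21 * t + 10" for j
      using that by blast
    have even: ?goal if "1 \<le> j" "j < 4 * t + 2" "F j + j + c = 19 * t + 10" for j
      using that less_imp_le by blast
    consider "c \<le> 4 * t + 2"
      | "4 * t + 2 < c" "c \<le> 5 * t + 2"
      | "5 * t + 2 < c" "c \<le> 6 * t + 2"
      | "6 * t + 2 < c" "c \<le> 6 * t + 3"
      | "6 * t + 3 < c" "c \<le> 7 * t + 4"
      | "7 * t + 4 < c" "c \<le> 8 * t + 4"
      | "8 * t + 4 < c" "c \<le> 10 * t + 4"
      | "10 * t + 4 < c" "c \<le> 12 * t + 5"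
      | "12 * t + 5 < c" "c \<le> 12 * t + 6"
      | "12 * t + 6 < c" "c \<le> 14 * t + 6"
      | "14 * t + 6 < c" "c \<le> 14 * t + 7"
      | "14 * t + 7 < c"
      using not_le by blast
    then show ?goal
    proof cases
      case 1
      show ?thesis by (rule even[of "t + 1"]; (subst F1)?; use 1 c c4 assms in linarith)
    next
      case 2
      show ?thesis by (rule edge[of "c - 3 * t - 1"]; (subst F3)?; use 2 c c4 assms in linarith)
    next
      case 3
      show ?thesis by (rule edge[of "c - 5 * t - 2"]; (subst F2)?; use 3 c c4 assms in linarith)
    next
      case 4
      show ?thesis by (rule odd[of "t + 1"]; (subst F1)?; use 4 c c4 assms in linarith)
    next
      case 5
      show ?thesis by (rule edge[of "c - 3 * t - 2"]; (subst F5)?; use 5 c c4 assms in linarith)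
    next
      case 6
      show ?thesis by (rule edge[of "c - 5 * t - 3"]; (subst F4)?; use 6 c c4 assms in linarith)
    next
      case 7
      show ?thesis
      proof (cases "even c")
        case True
        then obtain d where d: "c = 2 * d" by (elim evenE)
        show ?thesis by (rule even[of "8 * t + 4 - d"]; (subst F5)?; use d 7 c c4 assms in linarith)
      next
        case False
        then obtain d where d: "c = 2 * d + 1" by (elim oddE)
        show ?thesis by (rule even[of "7 * t + 3 - d"]; (subst F4)?; use d 7 c c4 assms in linarith)
      qed
    next
      case 8
      show ?thesis
      proof (cases "even c")
        case True
        then obtain d where d: "c = 2 * d" by (elim evenE)
        show ?thesis by (rule odd[of "8 * t + 4 - d"]; (subst F4)?; use d 8 c c4 assms in linarith)
      next
        case False
        then obtain d where d: "c = 2 * d + 1" by (elim oddE)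
        show ?thesis by (rule odd[of "9 * t + 4 - d"]; (subst F5)?; use d 8 c c4 assms in linarith)
      qed
    next
      case 9
      show ?thesis by (intro disjI1; subst F5; use 9 c c4 assms in linarith)
    next
      case 10
      show ?thesis
      proof (cases "even c")
        case True
        then obtain d where d: "c = 2 * d" by (elim evenE)
        show ?thesis
          by (rule even[of "7 * t + 4 - d"];
              (subst F2)?; use d 10 c c4 assms in linarith)
      next
        case False
        then obtain d where d: "c = 2 * d + 1" by (elim oddE)
        show ?thesis
          by (rule even[of "8 * t + 4 - d"];
              (subst F3)?; use d 10 c c4 assms in linarith)
      qed
    next
      case 11
      show ?thesis by (rule edge[of "t + 1"]; (subst F1)?; use 11 c c4 assms in linarith)
    next
      case 12
      show ?thesis
      proof (cases "even c")
        case True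
        then obtain d where d: "c = 2 * d" by (elim evenE)
        show ?thesis by (rule odd[of "9 * t + 5 - d"]; (subst F3)?; use d 12 c c4 assms in linarith)
      next
        case False
        then obtain d where d: "c = 2 * d + 1" by (elim oddE)
        show ?thesis by (rule odd[of "8 * t + 4 - d"]; (subst F2)?; use d 12 c c4 assms in linarith)
      qed
    qed
  next
    fix j assume "1 \<le> j" "j \<le> 4 * t + 2"
    then show "F j + j \<le> min (21 * t + 10) (19 * t + 10)" using Fmax[of j] assms by simp
  qed (use assms in auto)
  have "8 * t + 4 = 2 * (4 * t + 2)"
    by simp
  with tw show ?thesis
    by (simp only:)
qed

section \<open>Odd orders\<close>

lemma two_weight_path_3: "two_weight_path 3"
proof -
  have "two_weight_path (2 * 1 + 1)"
    by (rule two_weight_odd_path[of _ 5 8 "\<lambda>j. 2"]) auto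
  then show ?thesis by (simp add: numeral_eq_Suc)
qed

text \<open>For odd \<open>j\<close>, and likewise for even \<open>j < 2 * h\<close>, the edge labels and the two kinds of vertex labels
  each run through an interval as \<open>j\<close> decreases. Continuing the second run to \<open>j = 2 * h\<close> would
  give the edge, its odd end and its even end the labels \<open>3 * h + 1\<close>, \<open>4 * h + 1\<close> and \<open>6 * h + 1\<close>,
  but \<open>6 * h + 1\<close> is already taken at \<open>j = 1\<close>. Exchanging the first two replaces the third by
  the free label \<open>5 * h + 1\<close>.\<close>

lemma two_weight_path_4h_plus_1:
  assumes "h \<ge> 1"
  shows "two_weight_path (4 * h + 1)"
proof -
  define F where "F = (\<lambda>j. if odd j then 2 * h + (2 * h + 1 - j) div 2
    else if j = 2 * h then 4 * h + 1 else 3 * h + 1 + (2 * h - j) div 2)"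
  have F1: "F (2 * h + 1 - 2 * i) = 2 * h + i" if "i \<le> h" for i
    using that by (auto simp: F_def)
  have F2: "F (2 * h - 2 * i) = 3 * h + 1 + i" if "1 \<le> i" "i < h" for i
    using that by (auto simp: F_def)
  have F3: "F (2 * h) = 4 * h + 1"
    using assms by (auto simp: F_def)
  have Fmax: "F j \<le> 4 * h + 1" if "1 \<le> j" "j \<le> 2 * h" for j
    using that assms by (auto simp: F_def)
  have tw: "two_weight_path (2 * (2 * h) + 1)"
  proof (rule two_weight_odd_path[of _ "9 * h + 1" "11 * h + 2" F])
    fix c assume c: "2 * h < c" "c \<le> 4 * (2 * h) + 1"
    let ?goal = "2 * h + c = 9 * h + 1 \<or> (\<exists>j. 1 \<le> j \<and> j \<le> 2 * h \<and> (F j = c \<or>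
        (j - 1) + F j + c = 9 * h + 1 \<or> F j + j + c = 11 * h + 2))"
    have edge: ?goal if "1 \<le> j" "j \<le> 2 * h" "F j = c" for j
      using that by blast
    have odd: ?goal if "1 \<le> j" "j \<le> 2 * h" "(j - 1) + F j + c = 9 * h + 1" for j
      using that by blast
    have even: ?goal if "1 \<le> j" "j \<le> 2 * h" "F j + j + c = 11 * h + 2" for j
      using that by blast
    consider "c \<le> 3 * h"
      | "3 * h < c" "c \<le> 3 * h + 1"
      | "3 * h + 1 < c" "c \<le> 4 * h"
      | "4 * h < c" "c \<le> 4 * h + 1"
      | "4 * h + 1 < c" "c \<le> 5 * h"
      | "5 * h < c" "c \<le> 5 * h + 1"
      | "5 * h + 1 < c" "c \<le> 6 * h + 1"
      | "6 * h + 1 < c" "c \<le> 7 * h"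
      | "7 * h < c" "c \<le> 7 * h + 1"
      | "7 * h + 1 < c"
      using not_le by blast
    then show ?goal
    proof cases
      case 1
      then obtain i where i: "c = 2 * h + i" using less_imp_le le_Suc_ex c by metis
      show ?thesis by (rule edge[of "2 * h + 1 - 2 * i"]; (subst F1)?; use i 1 c assms in linarith)
    next
      case 2
      show ?thesis by (rule odd[of "2 * h"]; (subst F3)?; use 2 c assms in linarith)
    next
      case 3
      then obtain i where i: "c = 3 * h + 1 + i" using less_imp_le le_Suc_ex c by metis
      show ?thesis by (rule edge[of "2 * h - 2 * i"]; (subst F2)?; use i 3 c assms in linarith)
    next
      case 4
      show ?thesis by (rule edge[of "2 * h"]; (subst F3)?; use 4 c assms in linarith)
    next
      case 5
      then obtain i where i: "c = 4 * h + 1 + i" using less_imp_le le_Suc_ex c by metis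
      show ?thesis by (rule odd[of "2 * h - 2 * i"]; (subst F2)?; use i 5 c assms in linarith)
    next
      case 6
      show ?thesis by (rule even[of "2 * h"]; (subst F3)?; use 6 c assms in linarith)
    next
      case 7
      then obtain i where i: "c = 5 * h + 1 + i" using less_imp_le le_Suc_ex c by metis
      show ?thesis by (rule odd[of "2 * h + 1 - 2 * i"]; (subst F1)?; use i 7 c assms in linarith)
    next
      case 8
      then obtain i where i: "c = 6 * h + 1 + i" using less_imp_le le_Suc_ex c by metis
      show ?thesis by (rule even[of "2 * h - 2 * i"]; (subst F2)?; use i 8 c assms in linarith)
    next
      case 9
      show ?thesis by (rule disjI1) (use 9 in linarith)
    next
      case 10
      then obtain i where i: "c = 7 * h + 1 + i" using less_imp_le le_Suc_ex c by metis
      show ?thesis by (rule even[of "2 * h + 1 - 2 * i"]; (subst F1)?; use i 10 c assms in linarith)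
    qed
  next
    fix j assume "1 \<le> j" "j \<le> 2 * h"
    then show "F j + j \<le> min (9 * h + 1) (11 * h + 2)" using Fmax[of j] assms by simp
  qed (use assms in auto)
  have "4 * h + 1 = 2 * (2 * h) + 1"
    by simp
  with tw show ?thesis
    by (simp only:)
qed

text \<open>The same two runs. Here the second one would reach \<open>j = 2\<close> with the labels \<open>4 * h + 2\<close>,
  \<open>5 * h + 2\<close> and \<open>7 * h + 4\<close> of the edge, its odd end and its even end, while \<open>7 * h + 4\<close> belongs to
  the last vertex. The exchange replaces it by \<open>6 * h + 4\<close>.\<close>

lemma two_weight_path_4h_plus_3:
  assumes "h \<ge> 1"
  shows "two_weight_path (4 * h + 3)"
proof -
  define F where "F = (\<lambda>j. if odd j then 2 * h + 1 + (2 * h + 3 - j) div 2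
    else if j = 2 then 5 * h + 2 else 3 * h + 2 + (2 * h + 2 - j) div 2)"
  have F1: "F (2 * h + 3 - 2 * i) = 2 * h + 1 + i" if "i \<le> h + 1" for i
    using that by (auto simp: F_def)
  have F2: "F (2 * h + 2 - 2 * i) = 3 * h + 2 + i" if "1 \<le> i" "i < h" for i
    using that by (auto simp: F_def)
  have F3: "F 2 = 5 * h + 2"
    using assms by (auto simp: F_def)
  have Fmax: "F j \<le> 5 * h + 2" if "1 \<le> j" "j \<le> 2 * h + 1" for j
    using that assms by (auto simp: F_def)
  have tw: "two_weight_path (2 * (2 * h + 1) + 1)"
  proof (rule two_weight_odd_path[of _ "9 * h + 5" "11 * h + 8" F])
    fix c assume c: "2 * h + 1 < c" "c \<le> 4 * (2 * h + 1) + 1"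
    then have c4: "c < 8 * h + 6" by simp
    let ?goal = "2 * h + 1 + c = 9 * h + 5 \<or> (\<exists>j. 1 \<le> j \<and> j \<le> 2 * h + 1 \<and> (F j = c \<or>
        (j - 1) + F j + c = 9 * h + 5 \<or> F j + j + c = 11 * h + 8))"
    have edge: ?goal if "1 \<le> j" "j \<le> 2 * h + 1" "F j = c" for j
      using that by blast
    have odd: ?goal if "1 \<le> j" "j \<le> 2 * h + 1" "(j - 1) + F j + c = 9 * h + 5" for j
      using that by blast
    have even: ?goal if "1 \<le> j" "j \<le> 2 * h + 1" "F j + j + c = 11 * h + 8" for j
      using that by blast
    consider "c \<le> 3 * h + 2"
      | "3 * h + 2 < c" "c \<le> 4 * h + 1"
      | "4 * h + 1 < c" "c \<le> 4 * h + 2"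
      | "4 * h + 2 < c" "c \<le> 5 * h + 1"
      | "5 * h + 1 < c" "c \<le> 5 * h + 2"
      | "5 * h + 2 < c" "c \<le> 6 * h + 3"
      | "6 * h + 3 < c" "c \<le> 6 * h + 4"
      | "6 * h + 4 < c" "c \<le> 7 * h + 3"
      | "7 * h + 3 < c" "c \<le> 7 * h + 4"
      | "7 * h + 4 < c"
      using not_le by blast
    then show ?goal
    proof cases
      case 1
      then obtain i where i: "c = 2 * h + 1 + i" using less_imp_le le_Suc_ex c by metis
      show ?thesis
        by (rule edge[of "2 * h + 3 - 2 * i"];
            (subst F1)?; use i 1 c c4 assms in linarith)
    next
      case 2
      then obtain i where i: "c = 3 * h + 2 + i" using less_imp_le le_Suc_ex c by metis
      show ?thesis
        by (rule edge[of "2 * h + 2 - 2 * i"];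
            (subst F2)?; use i 2 c c4 assms in linarith)
    next
      case 3
      show ?thesis by (rule odd[of 2]; (subst F3)?; use 3 c c4 assms in linarith)
    next
      case 4
      then obtain i where i: "c = 4 * h + 2 + i" using less_imp_le le_Suc_ex c by metis
      show ?thesis
        by (rule odd[of "2 * h + 2 - 2 * i"];
            (subst F2)?; use i 4 c c4 assms in linarith)
    next
      case 5
      show ?thesis by (rule edge[of 2]; (subst F3)?; use 5 c c4 assms in linarith)
    next
      case 6
      then obtain i where i: "c = 5 * h + 2 + i" using less_imp_le le_Suc_ex c by metis
      show ?thesis
        by (rule odd[of "2 * h + 3 - 2 * i"];
            (subst F1)?; use i 6 c c4 assms in linarith)
    next
      case 7
      show ?thesis by (rule even[of 2]; (subst F3)?; use 7 c c4 assms in linarith)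
    next
      case 8
      then obtain i where i: "c = 6 * h + 4 + i" using less_imp_le le_Suc_ex c by metis
      show ?thesis
        by (rule even[of "2 * h + 2 - 2 * i"];
            (subst F2)?; use i 8 c c4 assms in linarith)
    next
      case 9
      show ?thesis by (rule disjI1) (use 9 in linarith)
    next
      case 10
      then obtain i where i: "c = 7 * h + 4 + i" using less_imp_le le_Suc_ex c by metis
      show ?thesis
        by (rule even[of "2 * h + 3 - 2 * i"];
            (subst F1)?; use i 10 c c4 assms in linarith)
    qed
  next
    fix j assume "1 \<le> j" "j \<le> 2 * h + 1"
    then show "F j + j \<le> min (9 * h + 5) (11 * h + 8)" using Fmax[of j] assms by simp
  qed (use assms in auto)
  have "4 * h + 3 = 2 * (2 * h + 1) + 1"
    by simp
  with tw show ?thesis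
    by (simp only:)
qed

section \<open>The path with four vertices\<close>

text \<open>The labels along the path are \<open>a, x, b, y, c, z, d\<close>, with edge labels \<open>x\<close>, \<open>y\<close>, \<open>z\<close>. Equal weights of
  the first and third vertex give \<open>a = y + c + z - x\<close>, and those of the second and fourth give
  \<open>d = x + b + y - z\<close>. Checking all choices of the other five labels shows that the two weights then
  agree. The distinctness conditions are interleaved with the quantifiers to prune
  the search.\<close>

lemma path_4_weights_coincide:
  "\<forall>x \<in> set [1..<8]. \<forall>y \<in> set [1..<8]. y \<noteq> x \<longrightarrow> (\<forall>z \<in> set [1..<8]. z \<noteq> x \<longrightarrow> z \<noteq> y \<longrightarrow>
    (\<forall>b \<in> set [1..<8]. b \<noteq> x \<longrightarrow> b \<noteq> y \<longrightarrow> b \<noteq> z \<longrightarrow> x + b + y - z < 8 \<longrightarrow>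
      (\<forall>c \<in> set [1..<8]. c \<noteq> x \<longrightarrow> c \<noteq> y \<longrightarrow> c \<noteq> z \<longrightarrow> c \<noteq> b \<longrightarrow> y + c + z - x < 8 \<longrightarrow>
       distinct [y + c + z - x, x, b, y, c, z, x + b + y - z] \<longrightarrow> y + c + z = x + b + (y::nat))))"
  by code_simp

lemma weights_path_4:
  "vertex_weight (path_graph 4) f 1 = f (Inl 1) + f (Inr {1, 2})"
  "vertex_weight (path_graph 4) f 2 = f (Inr {1, 2}) + f (Inl 2) + f (Inr {2, 3})"
  "vertex_weight (path_graph 4) f 3 = f (Inr {2, 3}) + f (Inl 3) + f (Inr {3, 4})"
  "vertex_weight (path_graph 4) f 4 = f (Inr {3, 4}) + f (Inl 4)"
  by (simp_all add: vertex_weight_path_graph del: One_nat_def) simp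

lemma verts_path_4: "verts (path_graph 4) = {1, 2, 3, 4}"
  by (auto simp: path_graph_def)

lemma edges_path_4: "edges (path_graph 4) = {{1, 2}, {2, 3}, {3, 4}}"
proof -
  have "{1..<4} = {1, 2, 3::nat}" by auto
  then show ?thesis by (simp add: edges_path_graph_eq del: One_nat_def)
qed

lemma three_weights_path_4:
  assumes "local_antimagic_total_labeling (path_graph 4) f"
  shows "card (vertex_weight (path_graph 4) f ` verts (path_graph 4)) \<ge> 3"
proof (rule ccontr)
  define w where "w = vertex_weight (path_graph 4) f"
  assume "\<not> ?thesis"
  then have few: "card {w 1, w 2, w 3, w 4} < 3"
    by (simp add: w_def verts_path_4)
  have ne: "w a \<noteq> w b" if "{a, b} \<in> edges (path_graph 4)" for a b
    using assms that unfolding local_antimagic_total_labeling_def w_def by blast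
  have "w 1 \<noteq> w 2" "w 2 \<noteq> w 3" "w 3 \<noteq> w 4"
    by (rule ne, simp add: edges_path_4)+
  with few have w13: "w 1 = w 3" and w24: "w 2 = w 4" and w12: "w 1 \<noteq> w 2"
    by (auto simp: card_insert_if split: if_splits)
  define L where "L = [Inl 1, Inr {1, 2}, Inl 2, Inr {2, 3}, Inl 3, Inr {3, 4}, Inl 4 :: nat + nat set]"
  have bij: "bij_betw f (set L) {1..7}"
  proof -
    have "set L = verts (path_graph 4) <+> edges (path_graph 4)"
      by (auto simp: L_def verts_path_4 edges_path_4)
    then show ?thesis
      using assms by (simp add: local_antimagic_total_labeling_def card_edges_path_graph)
  qed
  have "distinct L"
    by (simp add: L_def doubleton_eq_iff)
  then have "distinct (map f L)"
    using bij by (simp add: distinct_map bij_betw_def)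
  then have dist: "distinct [f (Inl 1), f (Inr {1, 2}), f (Inl 2), f (Inr {2, 3}), f (Inl 3),
      f (Inr {3, 4}), f (Inl 4)]"
    by (simp add: L_def)
  have "f e \<in> {1..7}" if "e \<in> set L" for e
    using bij_betwE[OF bij] that by blast
  then have rng: "f e \<in> set [1..<8]" if "e \<in> set L" for e
    using that by fastforce
  have mem: "f (Inr {1, 2}) \<in> set [1..<8]" "f (Inr {2, 3}) \<in> set [1..<8]"
    "f (Inr {3, 4}) \<in> set [1..<8]" "f (Inl 2) \<in> set [1..<8]" "f (Inl 3) \<in> set [1..<8]"
    by (rule rng, simp add: L_def)+
  have eqs: "f (Inl 1) = f (Inr {2, 3}) + f (Inl 3) + f (Inr {3, 4}) - f (Inr {1, 2})"
    "f (Inl 4) = f (Inr {1, 2}) + f (Inl 2) + f (Inr {2, 3}) - f (Inr {3, 4})"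
    using w13 w24 by (simp_all add: w_def weights_path_4 del: One_nat_def)
  have "f (Inr {2, 3}) + f (Inl 3) + f (Inr {3, 4}) = f (Inr {1, 2}) + f (Inl 2) + f (Inr {2, 3})"
  proof (rule path_4_weights_coincide
      [rule_format, OF mem(1,2) _ mem(3) _ _ mem(4) _ _ _ _ mem(5)])
    show "f (Inr {1, 2}) + f (Inl 2) + f (Inr {2, 3}) - f (Inr {3, 4}) < 8"
      "f (Inr {2, 3}) + f (Inl 3) + f (Inr {3, 4}) - f (Inr {1, 2}) < 8"
      unfolding eqs[symmetric] using rng[of "Inl 1"] rng[of "Inl 4"] by (simp_all add: L_def)
    show "distinct [f (Inr {2, 3}) + f (Inl 3) + f (Inr {3, 4}) - f (Inr {1, 2}), f (Inr {1, 2}),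
        f (Inl 2), f (Inr {2, 3}), f (Inl 3), f (Inr {3, 4}),
        f (Inr {1, 2}) + f (Inl 2) + f (Inr {2, 3}) - f (Inr {3, 4})]"
      using dist by (simp only: eqs)
  qed (use dist in auto)
  then show False
    using w12 w13 by (simp add: w_def weights_path_4 del: One_nat_def)
qed

text \<open>The labels along the path are \<open>1, 2, 3, 5, 7, 4, 6\<close>; the weights are \<open>3, 10, 16, 10\<close>.\<close>

lemma three_weight_labeling_path_4:
  "\<exists>f. local_antimagic_total_labeling (path_graph 4) f \<and>
     card (vertex_weight (path_graph 4) f ` verts (path_graph 4)) = 3"
proof -
  define v where "v = (!) [0, 1, 3, 7, 6::nat]"
  define g where "g = (!) [0, 2, 5, 4, 0::nat]"
  define f where "f = path_labeling v g"
  have w: "vertex_weight (path_graph 4) f u = g (u - 1) + v u + g u" if "1 \<le> u" "u \<le> 4" for u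
    unfolding f_def by (rule vertex_weight_path_labeling) (use that in \<open>auto simp: g_def\<close>)
  have ws: "vertex_weight (path_graph 4) f 1 = 3" "vertex_weight (path_graph 4) f 2 = 10"
    "vertex_weight (path_graph 4) f 3 = 16" "vertex_weight (path_graph 4) f 4 = 10"
    by (simp_all add: w v_def g_def)
  have "bij_betw f (verts (path_graph 4) <+> edges (path_graph 4))
     {1..card (verts (path_graph 4)) + card (edges (path_graph 4))}"
    unfolding f_def
  proof (rule bij_path_labeling)
    fix c :: nat assume "1 \<le> c" "c \<le> 2 * 4 - 1"
    then have "c \<in> {v 1, v 2, v 3, v 4} \<or> c \<in> {g 1, g 2, g 3}"
      by (auto simp: v_def g_def)
    then show "c \<in> v ` {1..4} \<or> c \<in> g ` {1..<4}"
      by auto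
  qed simp
  moreover have "vertex_weight (path_graph 4) f a \<noteq> vertex_weight (path_graph 4) f b"
    if "{a, b} \<in> edges (path_graph 4)" for a b
    using that ws by (auto simp: edges_path_4 doubleton_eq_iff)
  ultimately have "local_antimagic_total_labeling (path_graph 4) f"
    by (simp add: local_antimagic_total_labeling_def)
  moreover have "card (vertex_weight (path_graph 4) f ` verts (path_graph 4)) = 3"
    by (simp add: verts_path_4 ws card_insert_if del: One_nat_def)
  ultimately show ?thesis by blast
qed

section \<open>The local antimagic total chromatic number of paths\<close>

lemma chi_lat_eqI:
  assumes "\<exists>f. local_antimagic_total_labeling G f \<and> card (vertex_weight G f ` verts G) = k"
    and "\<And>f. local_antimagic_total_labeling G f \<Longrightarrow> k \<le> card (vertex_weight G f ` verts G)"
  shows "chi_lat G = k"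
  unfolding chi_lat_def by (rule Least_equality) (use assms in auto)

lemma two_le_weights_path:
  assumes "n \<ge> 2" "local_antimagic_total_labeling (path_graph n) f"
  shows "2 \<le> card (vertex_weight (path_graph n) f ` verts (path_graph n))"
proof -
  let ?w = "vertex_weight (path_graph n) f"
  have "{1, 2} \<in> edges (path_graph n)"
    using assms(1) edge_path_graph_iff[of 1 2 n] by simp
  then have "?w 1 \<noteq> ?w 2"
    using assms(2) unfolding local_antimagic_total_labeling_def by blast
  then have "2 = card {?w 1, ?w 2}"
    by simp
  also have "\<dots> \<le> card (?w ` verts (path_graph n))"
    by (rule card_mono) (use assms(1) in \<open>auto simp: path_graph_def\<close>)
  finally show ?thesis .
qed

text \<open>The five families cover all residues modulo eight. The order four is the excluded member
  \<open>t = 0\<close> of the family \<open>8 * t + 4\<close>.\<close>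

lemma two_weight_path_if_not_4:
  assumes "n \<ge> 2" "n \<noteq> 4"
  shows "two_weight_path n"
proof -
  have "(\<exists>h. n = 4 * h + 2) \<or> (\<exists>t\<ge>1. n = 8 * t) \<or> (\<exists>t\<ge>1. n = 8 * t + 4) \<or>
      (\<exists>h\<ge>1. n = 4 * h + 1) \<or> (\<exists>h\<ge>1. n = 4 * h + 3) \<or> n = 3"
    using assms by presburger
  then show ?thesis
    using two_weight_path_4h_plus_2 two_weight_path_8t two_weight_path_8t_plus_4
      two_weight_path_4h_plus_1 two_weight_path_4h_plus_3 two_weight_path_3 by blast
qed

theorem theorem3p14:
  fixes n :: nat
  assumes "n \<ge> 2"
  shows "chi_lat (path_graph n) = (if n = 4 then 3 else 2)"
proof (cases "n = 4")
  case True
  then show ?thesis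
    using chi_lat_eqI[OF three_weight_labeling_path_4 three_weights_path_4] by simp
next
  case False
  then have "\<exists>f. local_antimagic_total_labeling (path_graph n) f \<and>
      card (vertex_weight (path_graph n) f ` verts (path_graph n)) = 2"
    using two_weight_path_if_not_4[OF assms] by (simp add: two_weight_path_def)
  then have "chi_lat (path_graph n) = 2"
    by (rule chi_lat_eqI) (rule two_le_weights_path[OF assms])
  with False show ?thesis by simp
qed

end
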